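(* Let $p \ge 2$ be an integer, and let $$c = \frac{ \log \left(\frac{p}{p-1}\right) \log 2 }{ \log \left(\frac{2p}{p-1}\right) \log p },\qquad \widehat c = \frac{\log 2}{\log p}.$$ There exist constants $N>0$ and $b>0$ depending only on $p$, and for every $\alpha\in(0,1)$ a constant $\widehat b>0$ depending only on $\alpha$ and $p$, such that for every $\alpha \in (0,1)$ and every integer $n \ge N$ there exist pure $(\lfloor \log_p n \rfloor,1,p)$-composite rational functions $r$ and $q$ of type $(n-p+1,n)$ such that $$\max_{z \in S_p} \left|z \left( r(z) - \operatorname{sect}_p(z) \right)\right| \le \exp( -b n^c )$$ and $$\max_{z \in S_{p,\alpha}} \left| q(z) - \operatorname{sect}_p(z) \right| \le \exp( -\widehat b\, n^{\widehat c} ).$$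
   Context: A univariate rational function $r(x)=P(x)/Q(x)$ is of type $(m,\ell)$ if $P$ and $Q$ are polynomials of degrees at most $m$ and $\ell$, respectively. A rational function $r$ is pure $(k,m,\ell)$-composite if it is a composition $r(x) = r_k(r_{k-1}( \cdots (r_1(x))))$ of $k$ univariate rational functions $r_1,\dots,r_k$, each of type $(m,\ell)$. The $p$-sector function is $\operatorname{sect}_p(z)=z/(z^p)^{1/p}$ (principal $p$th root), so that $\operatorname{sect}_p(xe^{2\pi i j/p}) = e^{2\pi i j/p}$ for $x>0$ and $j\in\{1,\dots,p\}$. At $z=0$ the quantity $z\operatorname{sect}_p(z)$ is understood to be $0$. The sets are $$S_p = \{ x e^{2\pi i j/p} \mid x \in [0,1],\ j \in \{1,2,\dots,p\} \},\qquad S_{p,\alpha} = \{ x e^{2\pi i j/p} \mid x \in [\alpha,1],\ j \in \{1,2,\dots,p\} \}.$$ *)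

theory Defs
  imports
    "HOL-Analysis.Analysis"
    "HOL-Computational_Algebra.Polynomial_Factorial"
    "HOL-Computational_Algebra.Field_as_Ring"
begin

text \<open>
  Rational functions are elements of the field of fractions of the complex polynomials, so that
  they can be composed even where an intermediate value is infinite.
\<close>

type_synonym ratfun = "complex poly fract"

definition ratfun_type :: "nat \<Rightarrow> nat \<Rightarrow> ratfun \<Rightarrow> bool" where
  "ratfun_type m l r \<longleftrightarrow>
     (\<exists>P Q. degree P \<le> m \<and> degree Q \<le> l \<and> Q \<noteq> 0 \<and> r = Fract P Q)"

text \<open>
  The pair \<^term>\<open>quot_of_fract r\<close> is the representation of \<open>r\<close> in lowest terms, so removable
  singularities of a non-reduced representation do not count as poles.
  At a pole \<open>ratfun_eval\<close> has the junk value 0.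
\<close>

definition ratfun_pole :: "ratfun \<Rightarrow> complex \<Rightarrow> bool" where
  "ratfun_pole r z \<longleftrightarrow> poly (snd (quot_of_fract r)) z = 0"

definition ratfun_eval :: "ratfun \<Rightarrow> complex \<Rightarrow> complex" where
  "ratfun_eval r z = poly (fst (quot_of_fract r)) z / poly (snd (quot_of_fract r)) z"

definition poly_at_ratfun :: "complex poly \<Rightarrow> ratfun \<Rightarrow> ratfun" where
  "poly_at_ratfun P s = poly (map_poly (\<lambda>a. to_fract [:a:]) P) s"

text \<open>
  The composition \<open>t \<circ> s\<close> is a rational function unless \<open>s\<close> is a constant that is a pole
  of \<open>t\<close>; \<open>ratfun_composable\<close> excludes this case.
\<close>

definition ratfun_composable :: "ratfun \<Rightarrow> ratfun \<Rightarrow> bool" where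
  "ratfun_composable t s \<longleftrightarrow> poly_at_ratfun (snd (quot_of_fract t)) s \<noteq> 0"

definition ratfun_compose :: "ratfun \<Rightarrow> ratfun \<Rightarrow> ratfun" where
  "ratfun_compose t s =
     poly_at_ratfun (fst (quot_of_fract t)) s / poly_at_ratfun (snd (quot_of_fract t)) s"

text \<open>The composition of no rational functions is the identity \<open>x\<close>.\<close>

primrec pure_composite :: "nat \<Rightarrow> nat \<Rightarrow> nat \<Rightarrow> ratfun \<Rightarrow> bool" where
  "pure_composite 0 m l r \<longleftrightarrow> r = to_fract [:0, 1:]"
| "pure_composite (Suc k) m l r \<longleftrightarrow>
     (\<exists>s t. pure_composite k m l s \<and> ratfun_type m l t \<and> ratfun_composable t s \<and>
            r = ratfun_compose t s)"

text \<open>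
  Complex \<open>powr\<close> is the principal power. At 0 the quotient is \<open>0 / 0 = 0\<close>, which gives
  \<open>z * sect p z = 0\<close> there.
\<close>

definition sect :: "nat \<Rightarrow> complex \<Rightarrow> complex" where
  "sect p z = z / (z ^ p) powr (1 / of_nat p)"

definition S_rays :: "nat \<Rightarrow> real \<Rightarrow> complex set" where
  "S_rays p \<alpha> = {of_real x * exp (2 * of_real pi * \<i> * of_nat j / of_nat p) | x j.
                   x \<in> {\<alpha>..1} \<and> j \<in> {1..p}}"

abbreviation S_full :: "nat \<Rightarrow> complex set" where
  "S_full p \<equiv> S_rays p 0"


lemma ratfun_eval_Fract:
  assumes "poly Q z \<noteq> 0"
  shows "\<not> ratfun_pole (Fract P Q) z" "ratfun_eval (Fract P Q) z = poly P z / poly Q z"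
proof -
  have "Q \<noteq> 0" using assms by auto
  moreover have "quot_of_fract (Fract P Q) = normalize_quot (P, Q)"
    using quot_of_fract_quot_to_fract[of "(P, Q)"] by (simp add: quot_to_fract_def)
  ultimately obtain d where d: "P = fst (quot_of_fract (Fract P Q)) * d"
      "Q = snd (quot_of_fract (Fract P Q)) * d"
    by (metis normalize_quotE)
  have "poly P z = poly (fst (quot_of_fract (Fract P Q))) z * poly d z"
       "poly Q z = poly (snd (quot_of_fract (Fract P Q))) z * poly d z"
    using d by (metis poly_mult)+
  with assms show "\<not> ratfun_pole (Fract P Q) z"
      "ratfun_eval (Fract P Q) z = poly P z / poly Q z"
    by (auto simp: ratfun_pole_def ratfun_eval_def)
qed

lemma poly_at_ratfun_Fract:
  assumes "poly B z \<noteq> 0"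
  shows "\<exists>A' e. poly_at_ratfun P (Fract A B) = Fract A' (B ^ e) \<and>
           poly A' z = poly P (poly A z / poly B z) * poly B z ^ e"
proof (induction P)
  case 0
  show ?case by (intro exI[of _ 0] exI[of _ 0]) (simp add: poly_at_ratfun_def fract_collapse)
next
  case (pCons a P)
  then obtain A' e where IH: "poly_at_ratfun P (Fract A B) = Fract A' (B ^ e)"
    "poly A' z = poly P (poly A z / poly B z) * poly B z ^ e" by blast
  have B: "B \<noteq> 0" using assms by auto
  have "poly_at_ratfun (pCons a P) (Fract A B)
          = to_fract [:a:] + Fract A B * poly_at_ratfun P (Fract A B)"
    by (simp add: poly_at_ratfun_def map_poly_pCons)
  also have "\<dots> = Fract ([:a:] * B ^ Suc e + A * A') (B ^ Suc e)"
    using B by (simp add: IH to_fract_def)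
  finally show ?case
    using assms
    by (intro exI[of _ "[:a:] * B ^ Suc e + A * A'"] exI[of _ "Suc e"])
       (simp add: IH(2) algebra_simps)
qed

lemma ratfun_eval_compose:
  assumes "\<not> ratfun_pole s z" "\<not> ratfun_pole t (ratfun_eval s z)"
  shows "ratfun_composable t s" "\<not> ratfun_pole (ratfun_compose t s) z"
        "ratfun_eval (ratfun_compose t s) z = ratfun_eval t (ratfun_eval s z)"
proof -
  obtain A B where AB: "quot_of_fract s = (A, B)" by fastforce
  obtain P Q where PQ: "quot_of_fract t = (P, Q)" by fastforce
  have s: "s = Fract A B"
    by (metis AB quot_to_fract_quot_of_fract quot_to_fract_def case_prod_conv)
  have Bz: "poly B z \<noteq> 0" using assms(1) AB by (simp add: ratfun_pole_def)
  have w: "ratfun_eval s z = poly A z / poly B z" using AB by (simp add: ratfun_eval_def)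
  obtain P' e where P': "poly_at_ratfun P s = Fract P' (B ^ e)"
      "poly P' z = poly P (ratfun_eval s z) * poly B z ^ e"
    using poly_at_ratfun_Fract[OF Bz, of P A] s w by auto
  obtain Q' f where Q': "poly_at_ratfun Q s = Fract Q' (B ^ f)"
      "poly Q' z = poly Q (ratfun_eval s z) * poly B z ^ f"
    using poly_at_ratfun_Fract[OF Bz, of Q A] s w by auto
  have Qw: "poly Q (ratfun_eval s z) \<noteq> 0" using assms(2) PQ by (simp add: ratfun_pole_def)
  have Q'z: "poly Q' z \<noteq> 0" using Q'(2) Qw Bz by simp
  have "B \<noteq> 0" "Q' \<noteq> 0" using Bz Q'z by auto
  then show "ratfun_composable t s"
    by (simp add: ratfun_composable_def PQ Q'(1) Zero_fract_def eq_fract)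
  have c: "ratfun_compose t s = Fract (P' * B ^ f) (B ^ e * Q')"
    by (simp add: ratfun_compose_def PQ P'(1) Q'(1))
  have nz: "poly (B ^ e * Q') z \<noteq> 0" using Bz Q'z by simp
  show "\<not> ratfun_pole (ratfun_compose t s) z"
    unfolding c by (rule ratfun_eval_Fract[OF nz])
  have "ratfun_eval (ratfun_compose t s) z = poly P (ratfun_eval s z) / poly Q (ratfun_eval s z)"
    unfolding c ratfun_eval_Fract(2)[OF nz] using Bz Q'z by (simp add: P'(2) Q'(2))
  then show "ratfun_eval (ratfun_compose t s) z = ratfun_eval t (ratfun_eval s z)"
    using PQ by (simp add: ratfun_eval_def)
qed

lemma sect_ray:
  assumes "p > 0" "x > 0"
  shows "sect p (of_real x * exp (2 * of_real pi * \<i> * of_nat j / of_nat p))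
           = exp (2 * of_real pi * \<i> * of_nat j / of_nat p)"
proof -
  let ?u = "exp (2 * of_real pi * \<i> * of_nat j / of_nat p :: complex)"
  have "?u ^ p = exp (of_nat p * (2 * of_real pi * \<i> * of_nat j / of_nat p))"
    by (rule exp_of_nat_mult[symmetric])
  also have "of_nat p * (2 * of_real pi * \<i> * of_nat j / of_nat p) = 2 * of_int (int j) * of_real pi * \<i>"
    using assms by (simp add: field_simps)
  also have "exp \<dots> = (1 :: complex)" by (subst exp_eq_1) (auto intro: exI[of _ "int j"])
  finally have "(of_real x * ?u) ^ p = of_real (x ^ p)" by (simp add: power_mult_distrib)
  moreover have "of_real (x ^ p) powr (1 / of_nat p) = (of_real ((x ^ p) powr (1 / real p)) :: complex)"
    using assms powr_of_real[of "x ^ p" "1 / real p"] by simp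
  moreover have "(x ^ p) powr (1 / real p) = x"
  proof -
    have "(x ^ p) powr (1 / real p) = (x powr real p) powr (1 / real p)"
      using assms by (simp add: powr_realpow)
    also have "\<dots> = x" using assms unfolding powr_powr by simp
    finally show ?thesis .
  qed
  ultimately show ?thesis using assms by (simp add: sect_def)
qed

end

theory Submission
  imports Defs
begin

text \<open>
  Let \<open>G u = p u / (p - 1 + u ^ p)\<close>. This function commutes with multiplication by \<open>p\<close>-th
  roots of unity, so a composition of scaled copies \<open>x \<mapsto> G (x / s)\<close> maps a point \<open>x \<omega>\<close> of a ray,
  with \<open>\<omega> ^ p = 1\<close>, to \<open>f x * \<omega>\<close>, where \<open>f\<close> is the same composition on the real interval
  \<open>[0, 1]\<close>. Hence the error at \<open>x \<omega>\<close>, for \<open>x > 0\<close>, is \<open>\<bar>f x - 1\<bar>\<close>, and only real estimates are needed.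
  The function \<open>G\<close> takes values in \<open>[0, 1]\<close> on the nonnegative reals, with \<open>G 1 = 1\<close>.

  Two properties of \<open>G\<close> carry the proof. Without scaling, convergence to 1 is quadratic on the whole
  of \<open>[0, 1]\<close> when measured by \<open>1 - x ^ p\<close>: one has \<open>1 - G x ^ p \<le> (1 - x ^ p)\<^sup>2\<close>
  (\<open>sector_step_quadratic\<close>). With the scaling \<open>s = a powr (1 / p)\<close>, the interval \<open>[a, 1]\<close> is mapped
  into \<open>[a powr ((p - 1) / p), 1]\<close> (\<open>sector_step_scaled\<close>), because \<open>G u \<ge> u\<close> for \<open>u \<le> 1\<close> and
  \<open>G u \<ge> 1 / u ^ (p - 1)\<close> for \<open>u \<ge> 1\<close>. So a scaled step multiplies the logarithm of
  the left endpoint by \<open>(p - 1) / p\<close>.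

  Let \<open>k\<close> be the integer part of \<open>log p n\<close>. On \<open>[\<alpha>, 1]\<close> with fixed \<open>\<alpha> > 0\<close>, taking \<open>k\<close> unscaled
  steps gives an error of at most \<open>(1 - \<alpha> ^ p) ^ (2 ^ k)\<close>, and \<open>2 ^ k\<close> is comparable to
  \<open>n powr (ln 2 / ln p)\<close>. On \<open>[0, 1]\<close>, with the error weighted by \<open>x\<close>, put \<open>T = (p / (p - 1)) ^ k1\<close>:
  the points \<open>x \<le> exp (- T)\<close> are harmless, \<open>k1\<close> scaled steps map \<open>[exp (- T), 1]\<close> into
  \<open>[exp (- 1), 1]\<close>, and \<open>k - k1\<close> unscaled steps reduce the error to \<open>exp (- \<beta> * 2 ^ (k - k1))\<close> with
  \<open>\<beta> > 0\<close> depending only on \<open>p\<close>. Balancing \<open>(p / (p - 1)) ^ k1\<close> against \<open>2 ^ (k - k1)\<close>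
  gives the exponent \<open>c\<close>.
\<close>

section \<open>The sector iteration on the unit interval\<close>

text \<open>
  One step \<open>x \<mapsto> G (x / s)\<close>. For \<open>s = 1\<close> this is the unscaled step, which has 1 as a fixed point with
  vanishing derivative.
\<close>

definition sector_step :: "nat \<Rightarrow> real \<Rightarrow> real \<Rightarrow> real" where
  "sector_step p s x = real p * (x / s) / ((real p - 1) + (x / s) ^ p)"

text \<open>
  The composition of the first \<open>k\<close> steps for the sequence of scales \<open>\<sigma>\<close>; the step with scale \<open>\<sigma> 0\<close>
  is applied first.
\<close>

primrec sector_iter :: "nat \<Rightarrow> (nat \<Rightarrow> real) \<Rightarrow> nat \<Rightarrow> real \<Rightarrow> real" where
  "sector_iter p \<sigma> 0 x = x"
| "sector_iter p \<sigma> (Suc k) x = sector_step p (\<sigma> k) (sector_iter p \<sigma> k x)"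

lemma sector_step_denom_pos:
  assumes "p \<ge> 2" "s > 0" "x \<ge> 0"
  shows "(real p - 1) + (x / s) ^ p > 0"
proof -
  have "(x / s) ^ p \<ge> 0" using assms by simp
  moreover have "real p \<ge> 2" using assms by simp
  ultimately show ?thesis by linarith
qed

lemma sector_step_nonneg:
  assumes "p \<ge> 2" "s > 0" "x \<ge> 0"
  shows "sector_step p s x \<ge> 0"
  using sector_step_denom_pos[OF assms] assms by (simp add: sector_step_def)

text \<open>The bound is Bernoulli's inequality \<open>1 + p (u - 1) \<le> u ^ p\<close> at \<open>u = x / s\<close>.\<close>

lemma sector_step_le_1:
  assumes "p \<ge> 2" "s > 0" "x \<ge> 0"
  shows "sector_step p s x \<le> 1"
proof -
  have "1 + real p * (x / s - 1) \<le> (1 + (x / s - 1)) ^ p"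
    using assms by (intro Bernoulli_inequality) simp
  then have "real p * (x / s) \<le> (real p - 1) + (x / s) ^ p"
    by (simp add: algebra_simps)
  then show ?thesis
    unfolding sector_step_def using sector_step_denom_pos[OF assms] by (subst pos_divide_le_eq) simp_all
qed

lemma sector_step_ge_self:
  assumes "p \<ge> 2" "s > 0" "x \<ge> 0" "x \<le> s"
  shows "sector_step p s x \<ge> x / s"
proof -
  have "(x / s) ^ p \<le> 1" using assms by (intro power_le_one) auto
  then have "(x / s) * ((real p - 1) + (x / s) ^ p) \<le> (x / s) * real p"
    using assms by (intro mult_left_mono) auto
  then show ?thesis
    unfolding sector_step_def using sector_step_denom_pos[OF assms(1-3)]
    by (subst pos_le_divide_eq) (simp_all add: mult.commute)
qed

lemma sector_step_ge_power:
  assumes "p \<ge> 2" "s > 0" "x \<ge> s"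
  shows "sector_step p s x \<ge> (s / x) ^ (p - 1)"
proof -
  have x: "x > 0" using assms by linarith
  have "(x / s) ^ p \<ge> 1" using assms by (intro one_le_power) auto
  moreover have "real p \<ge> 1" using assms by simp
  ultimately have "0 \<le> (real p - 1) * ((x / s) ^ p - 1)" by simp
  then have le: "(real p - 1) + (x / s) ^ p \<le> real p * (x / s) ^ p"
    by (simp add: algebra_simps)
  have "(x / s) ^ p = (x / s) * (x / s) ^ (p - 1)"
    using assms by (cases p) auto
  then have "(s / x) ^ (p - 1) * (x / s) ^ p = x / s"
    using assms x by (simp add: power_divide)
  then have "(s / x) ^ (p - 1) * ((real p - 1) + (x / s) ^ p) \<le> real p * (x / s)"
    using mult_left_mono[OF le, of "(s / x) ^ (p - 1)"] assms x by (simp add: algebra_simps)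
  then show ?thesis
    unfolding sector_step_def using sector_step_denom_pos[of p s x] assms x
    by (subst pos_le_divide_eq) simp_all
qed

text \<open>
  The step with scale \<open>s = a powr (1 / p)\<close>, written with \<open>a = exp (- T)\<close>. This \<open>s\<close> balances the two
  lower bounds at the endpoints: \<open>a / s = s ^ (p - 1)\<close>.
\<close>

lemma sector_step_scaled:
  assumes "p \<ge> 2" "T \<ge> 0" "exp (- T) \<le> x" "x \<le> 1"
  shows "sector_step p (exp (- T / real p)) x \<ge> exp (- (T * ((real p - 1) / real p)))"
proof (cases "x \<le> exp (- T / real p)")
  case True
  have "exp (- (T * ((real p - 1) / real p))) = exp (- T) / exp (- T / real p)"
    using assms by (simp add: exp_diff[symmetric] field_simps)
  also have "\<dots> \<le> x / exp (- T / real p)"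
    using assms by (intro divide_right_mono) auto
  also have "\<dots> \<le> sector_step p (exp (- T / real p)) x"
    using assms True less_le_trans[OF exp_gt_zero assms(3)]
    by (intro sector_step_ge_self) auto
  finally show ?thesis .
next
  case False
  have x: "x > 0" using less_le_trans[OF exp_gt_zero assms(3)] .
  have "exp (- (T * ((real p - 1) / real p))) = exp (- T / real p) ^ (p - 1)"
    using assms by (simp add: exp_of_nat_mult[symmetric] of_nat_diff field_simps)
  also have "\<dots> \<le> (exp (- T / real p) / x) ^ (p - 1)"
    using assms x by (intro power_mono) (auto simp: field_simps mult_left_le)
  also have "\<dots> \<le> sector_step p (exp (- T / real p)) x"
    using assms False by (intro sector_step_ge_power) auto
  finally show ?thesis .
qed

text \<open>
  With \<open>w = 1 - x ^ p\<close> one has \<open>G x ^ p = (1 - w) / (1 - w / p) ^ p\<close>, and the claim reduces to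
  \<open>(1 + w) * (1 - w / p) ^ p \<le> 1\<close>, which follows from \<open>1 + t \<le> exp t\<close> at \<open>t = w\<close> and \<open>t = - w / p\<close>.
\<close>

lemma sector_step_quadratic:
  assumes "p \<ge> 2" "0 \<le> x" "x \<le> 1"
  shows "1 - sector_step p 1 x ^ p \<le> (1 - x ^ p)\<^sup>2"
proof -
  define w where "w = 1 - x ^ p"
  have w: "0 \<le> w" "w \<le> 1" using assms by (auto simp: w_def power_le_one)
  have pos: "1 - w / real p > 0" using w assms by (simp add: field_simps)
  have step: "sector_step p 1 x = x / (1 - w / real p)"
    using assms pos sector_step_denom_pos[of p 1 x] by (simp add: sector_step_def w_def field_simps)
  have "(1 - w / real p) ^ p \<le> exp (- w / real p) ^ p"
    using exp_ge_add_one_self[of "- w / real p"] pos by (intro power_mono) auto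
  also have "\<dots> = exp (- w)" using assms by (simp add: exp_of_nat_mult[symmetric])
  finally have "(1 + w) * (1 - w / real p) ^ p \<le> exp w * exp (- w)"
    using w pos exp_ge_add_one_self[of w] by (intro mult_mono) auto
  then have "(1 + w) * (1 - w / real p) ^ p \<le> 1" by (simp add: exp_minus)
  then have "(1 - w) * ((1 + w) * (1 - w / real p) ^ p) \<le> (1 - w) * 1"
    using w by (intro mult_left_mono) auto
  then have "(1 - w\<^sup>2) * (1 - w / real p) ^ p \<le> x ^ p"
    by (simp add: w_def power2_eq_square algebra_simps)
  then have "1 - w\<^sup>2 \<le> sector_step p 1 x ^ p"
    using pos by (simp add: step power_divide pos_le_divide_eq)
  then show ?thesis by (simp add: w_def)
qed

lemma sector_iter_bounds:
  assumes "p \<ge> 2" "\<forall>i. \<sigma> i > 0" "0 \<le> x" "x \<le> 1"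
  shows "0 \<le> sector_iter p \<sigma> k x \<and> sector_iter p \<sigma> k x \<le> 1"
  using assms by (induction k) (auto intro: sector_step_nonneg sector_step_le_1)

lemma sector_iter_scaled:
  assumes "p \<ge> 2" "\<forall>i. \<sigma> i > 0" "T \<ge> 0" "exp (- T) \<le> x" "x \<le> 1"
    and "\<And>i. i < k \<Longrightarrow> \<sigma> i = exp (- (T * ((real p - 1) / real p) ^ i) / real p)"
  shows "sector_iter p \<sigma> k x \<ge> exp (- (T * ((real p - 1) / real p) ^ k))"
  using assms(6)
proof (induction k)
  case 0
  then show ?case using assms by simp
next
  case (Suc k)
  let ?T = "T * ((real p - 1) / real p) ^ k"
  have x: "x \<ge> 0" using less_le_trans[OF exp_gt_zero assms(4)] by simp
  have "exp (- (?T * ((real p - 1) / real p))) \<le> sector_step p (exp (- ?T / real p)) (sector_iter p \<sigma> k x)"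
    using assms Suc sector_iter_bounds[of p \<sigma> x k] x by (intro sector_step_scaled) auto
  then show ?case using Suc.prems[of k] by (simp add: mult_ac)
qed

lemma sector_iter_unscaled:
  assumes "p \<ge> 2" "\<forall>i. \<sigma> i > 0" "0 \<le> x" "x \<le> 1"
    and "\<And>i. k \<le> i \<Longrightarrow> \<sigma> i = 1"
  shows "1 - sector_iter p \<sigma> (k + m) x \<le> (1 - sector_iter p \<sigma> k x ^ p) ^ (2 ^ m)"
proof -
  have bounds: "0 \<le> sector_iter p \<sigma> j x \<and> sector_iter p \<sigma> j x \<le> 1" for j
    using assms(1-4) by (rule sector_iter_bounds)
  have "1 - sector_iter p \<sigma> (k + m) x ^ p \<le> (1 - sector_iter p \<sigma> k x ^ p) ^ (2 ^ m)"
  proof (induction m)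
    case (Suc m)
    let ?y = "sector_iter p \<sigma> (k + m) x"
    have "1 - sector_iter p \<sigma> (k + Suc m) x ^ p \<le> (1 - ?y ^ p)\<^sup>2"
      using bounds[of "k + m"] assms by (simp add: sector_step_quadratic)
    also have "\<dots> \<le> ((1 - sector_iter p \<sigma> k x ^ p) ^ (2 ^ m))\<^sup>2"
      using bounds[of "k + m"] Suc.IH by (intro power_mono) (auto simp: power_le_one)
    finally show ?case by (simp add: power_mult[symmetric] mult.commute)
  qed simp
  moreover have "sector_iter p \<sigma> (k + m) x ^ p \<le> sector_iter p \<sigma> (k + m) x"
    using bounds[of "k + m"] assms(1) power_decreasing[of 1 p "sector_iter p \<sigma> (k + m) x"] by simp
  ultimately show ?thesis by linarith
qed

section \<open>Substitution of rational functions into polynomials\<close>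

lemma poly_at_ratfun_pCons:
  "poly_at_ratfun (pCons a P) s = to_fract [:a:] + s * poly_at_ratfun P s"
  by (simp add: poly_at_ratfun_def map_poly_pCons)

lemma poly_at_ratfun_0: "poly_at_ratfun 0 s = 0"
  by (simp add: poly_at_ratfun_def)

lemma poly_at_ratfun_add:
  "poly_at_ratfun (P + Q) s = poly_at_ratfun P s + poly_at_ratfun Q s"
proof (induction P arbitrary: Q)
  case (pCons a P)
  show ?case
  proof (cases Q)
    case (pCons b R)
    have "to_fract [:a + b:] = to_fract [:a:] + to_fract [:b :: complex:]"
      by (simp flip: to_fract_add)
    then show ?thesis
      using pCons.IH[of R] pCons by (simp add: poly_at_ratfun_pCons algebra_simps)
  qed
qed (simp add: poly_at_ratfun_0)

lemma poly_at_ratfun_smult: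
  "poly_at_ratfun (smult a P) s = to_fract [:a:] * poly_at_ratfun P s"
proof (induction P)
  case (pCons b P)
  have "to_fract [:a * b:] = to_fract [:a:] * to_fract [:b :: complex:]"
    by (simp flip: to_fract_mult)
  then show ?case
    using pCons.IH by (simp add: poly_at_ratfun_pCons algebra_simps)
qed (simp add: poly_at_ratfun_0)

lemma poly_at_ratfun_mult:
  "poly_at_ratfun (P * Q) s = poly_at_ratfun P s * poly_at_ratfun Q s"
proof (induction P)
  case (pCons a P)
  have "to_fract [:0 :: complex:] = 0" by simp
  then show ?case
    using pCons.IH
    by (simp add: mult_pCons_left poly_at_ratfun_add poly_at_ratfun_smult
        poly_at_ratfun_pCons algebra_simps)
qed (simp add: poly_at_ratfun_0)

lemma poly_at_ratfun_monom:
  "poly_at_ratfun (monom a n) s = to_fract [:a:] * s ^ n"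
proof (induction n)
  case 0
  then show ?case by (simp add: monom_0 poly_at_ratfun_pCons poly_at_ratfun_0)
next
  case (Suc n)
  have "to_fract [:0 :: complex:] = 0" by simp
  with Suc show ?case by (simp add: monom_Suc poly_at_ratfun_pCons)
qed

text \<open>
  Composition is defined through lowest terms; any other representation of the outer function gives
  the same result as long as its denominator does not vanish identically at \<open>s\<close>, since a common
  factor cancels after the substitution.
\<close>

lemma ratfun_compose_Fract:
  assumes "poly_at_ratfun B s \<noteq> 0"
  shows "ratfun_composable (Fract A B) s"
    and "ratfun_compose (Fract A B) s = poly_at_ratfun A s / poly_at_ratfun B s"
proof -
  have "B \<noteq> 0" using assms by (auto simp: poly_at_ratfun_0)
  moreover have "quot_of_fract (Fract A B) = normalize_quot (A, B)"
    using quot_of_fract_quot_to_fract[of "(A, B)"] by (simp add: quot_to_fract_def)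
  ultimately obtain d where d: "A = fst (quot_of_fract (Fract A B)) * d"
      "B = snd (quot_of_fract (Fract A B)) * d"
    by (metis normalize_quotE)
  have A: "poly_at_ratfun A s = poly_at_ratfun (fst (quot_of_fract (Fract A B))) s * poly_at_ratfun d s"
    using d(1) by (metis poly_at_ratfun_mult)
  have B: "poly_at_ratfun B s = poly_at_ratfun (snd (quot_of_fract (Fract A B))) s * poly_at_ratfun d s"
    using d(2) by (metis poly_at_ratfun_mult)
  show "ratfun_composable (Fract A B) s"
    using assms B by (auto simp: ratfun_composable_def)
  show "ratfun_compose (Fract A B) s = poly_at_ratfun A s / poly_at_ratfun B s"
    using assms A B by (simp add: ratfun_compose_def)
qed

lemma ratfun_compose_sector:
  fixes a b c :: complex
  assumes "Q \<noteq> 0" "p > 0" "smult a (P ^ p) + smult b (Q ^ p) \<noteq> 0"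
  defines "t \<equiv> Fract [:0, c:] (monom a p + [:b:])"
  shows "ratfun_composable t (Fract P Q)"
    and "ratfun_compose t (Fract P Q) =
           Fract (smult c (P * Q ^ (p - 1))) (smult a (P ^ p) + smult b (Q ^ p))"
proof -
  let ?s = "Fract P Q"
  have pow: "?s ^ n = Fract (P ^ n) (Q ^ n)" for n
    using assms(1) by (induction n) (auto simp: One_fract_def)
  have "to_fract [:0 :: complex:] = 0" by simp
  then have num: "poly_at_ratfun [:0, c:] ?s = Fract ([:c:] * P) Q"
    using assms(1) by (simp add: poly_at_ratfun_pCons poly_at_ratfun_0 to_fract_def mult.commute)
  have den: "poly_at_ratfun (monom a p + [:b:]) ?s = Fract (smult a (P ^ p) + smult b (Q ^ p)) (Q ^ p)"
    using assms(1)
    by (simp add: poly_at_ratfun_add poly_at_ratfun_monom poly_at_ratfun_pCons poly_at_ratfun_0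
        pow to_fract_def)
  have nz: "poly_at_ratfun (monom a p + [:b:]) ?s \<noteq> 0"
    using assms by (simp add: den Zero_fract_def eq_fract)
  show "ratfun_composable t ?s"
    unfolding t_def by (rule ratfun_compose_Fract(1)[OF nz])
  have Q_power: "Q ^ p = Q * Q ^ (p - 1)" using assms(2) by (cases p) auto
  define D where "D = smult a (P ^ p) + smult b (Q ^ p)"
  have "D \<noteq> 0" using assms(3) by (simp add: D_def)
  have "ratfun_compose t ?s = Fract ([:c:] * P * Q ^ p) (Q * D)"
    unfolding t_def ratfun_compose_Fract(2)[OF nz] num den D_def by simp
  also have "\<dots> = Fract (smult c (P * Q ^ (p - 1))) D"
    unfolding Q_power using \<open>D \<noteq> 0\<close> assms(1)
    by (simp add: eq_fract algebra_simps)
  finally show "ratfun_compose t ?s =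
           Fract (smult c (P * Q ^ (p - 1))) (smult a (P ^ p) + smult b (Q ^ p))"
    by (simp only: D_def)
qed

section \<open>Composite rational functions realizing the sector iteration\<close>

text \<open>
  The bound \<open>p ^ k - p + 1\<close> on the numerator degree is preserved because a step replaces \<open>P\<close> by a multiple of
  \<open>P * Q ^ (p - 1)\<close>. It fails at \<open>k = 0\<close>, where \<open>P\<close> is the identity and
  \<open>Q\<close> is constant; this exception is part of the induction hypothesis.
\<close>

lemma pure_composite_sector_iter:
  fixes \<sigma> :: "nat \<Rightarrow> real"
  assumes p: "p \<ge> 2" and \<sigma>: "\<forall>i. \<sigma> i > 0"
  shows "\<exists>P Q. pure_composite k 1 p (Fract P Q) \<and> Q \<noteq> 0 \<and> degree Q \<le> p ^ k \<and>
           (degree P + (p - 1) \<le> p ^ k \<or> k = 0 \<and> degree P \<le> 1 \<and> degree Q = 0) \<and>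
           (\<forall>x \<omega>. 0 \<le> x \<longrightarrow> x \<le> 1 \<longrightarrow> \<omega> ^ p = 1 \<longrightarrow>
              poly Q (of_real x * \<omega>) \<noteq> 0 \<and>
              poly P (of_real x * \<omega>) / poly Q (of_real x * \<omega>) = \<omega> * of_real (sector_iter p \<sigma> k x))"
proof (induction k)
  case 0
  show ?case
    by (intro exI[of _ "[:0, 1:]"] exI[of _ 1]) (simp add: to_fract_def)
next
  case (Suc k)
  then obtain P Q where IH: "pure_composite k 1 p (Fract P Q)" "Q \<noteq> 0" "degree Q \<le> p ^ k"
    "degree P + (p - 1) \<le> p ^ k \<or> k = 0 \<and> degree P \<le> 1 \<and> degree Q = 0"
    and val: "\<And>x \<omega>. 0 \<le> x \<Longrightarrow> x \<le> 1 \<Longrightarrow> \<omega> ^ p = 1 \<Longrightarrow> poly Q (of_real x * \<omega>) \<noteq> 0"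
      "\<And>x \<omega>. 0 \<le> x \<Longrightarrow> x \<le> 1 \<Longrightarrow> \<omega> ^ p = 1 \<Longrightarrow>
         poly P (of_real x * \<omega>) / poly Q (of_real x * \<omega>) = \<omega> * of_real (sector_iter p \<sigma> k x)"
    by blast
  define s where "s = \<sigma> k"
  have s: "s > 0" using \<sigma> by (simp add: s_def)
  define a b c :: complex where "a = of_real (1 / s ^ p)" and "b = of_real (real p - 1)"
    and "c = of_real (real p / s)"
  define P' where "P' = smult c (P * Q ^ (p - 1))"
  define Q' where "Q' = smult a (P ^ p) + smult b (Q ^ p)"
  have val': "poly Q' (of_real x * \<omega>) \<noteq> 0 \<and>
      poly P' (of_real x * \<omega>) / poly Q' (of_real x * \<omega>) = \<omega> * of_real (sector_iter p \<sigma> (Suc k) x)"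
    if x: "0 \<le> x" "x \<le> 1" "\<omega> ^ p = 1" for x \<omega>
  proof -
    define f where "f = sector_iter p \<sigma> k x"
    define v where "v = poly Q (of_real x * \<omega>)"
    have f: "f \<ge> 0" using sector_iter_bounds[of p \<sigma> x k] p \<sigma> x by (simp add: f_def)
    have v: "v \<noteq> 0" using val(1)[OF x] by (simp add: v_def)
    have Pv: "poly P (of_real x * \<omega>) = \<omega> * of_real f * v"
      using val(2)[OF x] v by (simp add: f_def v_def divide_eq_eq)
    define D where "D = (real p - 1) + (f / s) ^ p"
    have D: "D > 0" unfolding D_def using p s f by (rule sector_step_denom_pos)
    have Q': "poly Q' (of_real x * \<omega>) = of_real D * v ^ p"
    proof -
      have "poly Q' (of_real x * \<omega>) = a * (\<omega> * of_real f * v) ^ p + b * v ^ p"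
        unfolding Q'_def poly_add poly_smult poly_power Pv by (simp add: v_def)
      also have "(\<omega> * of_real f * v) ^ p = of_real f ^ p * v ^ p"
        by (simp add: power_mult_distrib x(3))
      also have "a * (of_real f ^ p * v ^ p) + b * v ^ p = of_real D * v ^ p"
        by (simp add: D_def a_def b_def power_divide algebra_simps)
      finally show ?thesis .
    qed
    have P': "poly P' (of_real x * \<omega>) = c * \<omega> * of_real f * v ^ p"
    proof -
      have "v ^ p = v * v ^ (p - 1)" using p by (cases p) auto
      then show ?thesis
        unfolding P'_def poly_smult poly_mult poly_power Pv v_def[symmetric] by simp
    qed
    have "c * \<omega> * of_real f * v ^ p / (of_real D * v ^ p) = \<omega> * (c * of_real f / of_real D)"
      using v by simp
    also have "c * of_real f / of_real D = of_real (sector_step p s f)"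
      by (simp add: sector_step_def D_def c_def)
    finally show ?thesis
      using v D by (simp add: P' Q' f_def s_def)
  qed
  (* The value at the point 0 shows that the denominator is not the zero polynomial. *)
  have Q'_nz: "Q' \<noteq> 0" using val'[of 0 1] by auto
  have type: "ratfun_type 1 p (Fract [:0, c:] (monom a p + [:b:]))"
  proof -
    have "b \<noteq> 0" using p by (auto simp only: b_def of_real_eq_0_iff)
    then have "poly (monom a p + [:b:]) 0 \<noteq> 0"
      using p by (simp add: poly_monom power_0_left)
    then have "monom a p + [:b:] \<noteq> 0" by force
    moreover have "degree (monom a p + [:b:]) \<le> p"
      by (intro degree_add_le) (auto simp: degree_monom_le)
    ultimately show ?thesis
      unfolding ratfun_type_def by (intro exI[of _ "[:0, c:]"] exI[of _ "monom a p + [:b:]"]) simp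
  qed
  have "pure_composite (Suc k) 1 p (Fract P' Q')"
    using IH(1) type ratfun_compose_sector[of Q p a P b c] IH(2) p Q'_nz
    unfolding pure_composite.simps P'_def Q'_def
    by (intro exI[of _ "Fract P Q"] exI[of _ "Fract [:0, c:] (monom a p + [:b:])"]) auto
  moreover have "degree P \<le> p ^ k" using IH(4) by auto
  then have "degree (P ^ p) \<le> p ^ Suc k" "degree (Q ^ p) \<le> p ^ Suc k"
    using degree_power_le[of P p] degree_power_le[of Q p] IH(3)
    by (simp_all add: order.trans mult.commute)
  then have "degree Q' \<le> p ^ Suc k"
    unfolding Q'_def by (intro degree_add_le) (auto intro: order.trans[OF degree_smult_le])
  moreover have "degree P' + (p - 1) \<le> p ^ Suc k"
  proof -
    have "degree P' \<le> degree P + degree (Q ^ (p - 1))"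
      unfolding P'_def by (rule order.trans[OF degree_smult_le degree_mult_le])
    also have "degree (Q ^ (p - 1)) \<le> degree Q * (p - 1)"
      by (rule degree_power_le)
    finally have P': "degree P' \<le> degree P + degree Q * (p - 1)" by simp
    have split: "p ^ Suc k = p ^ k + p ^ k * (p - 1)"
      using p by (cases p) auto
    show ?thesis
      using IH(4)
    proof
      assume "degree P + (p - 1) \<le> p ^ k"
      moreover have "degree Q * (p - 1) \<le> p ^ k * (p - 1)"
        using IH(3) by (rule mult_le_mono1)
      ultimately show ?thesis using P' split by linarith
    next
      assume "k = 0 \<and> degree P \<le> 1 \<and> degree Q = 0"
      then have "degree P' \<le> 1" "k = 0" using P' by auto
      then show ?thesis using p by simp
    qed
  qed
  ultimately show ?case
    using Q'_nz val' by blast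
qed

text \<open>
  The error formula fails at \<open>x = 0\<close>, where both the rational function and \<open>sect p\<close> vanish.
\<close>

lemma sector_iter_ratfun:
  fixes \<sigma> :: "nat \<Rightarrow> real"
  assumes p: "p \<ge> 2" and \<sigma>: "\<forall>i. \<sigma> i > 0" and k: "k > 0" and n: "p ^ k \<le> n"
  obtains r where "pure_composite k 1 p r" "ratfun_type (n + 1 - p) n r"
    "\<And>z \<alpha>. \<alpha> \<ge> 0 \<Longrightarrow> z \<in> S_rays p \<alpha> \<Longrightarrow> \<not> ratfun_pole r z"
    "\<And>z \<alpha>. \<alpha> \<ge> 0 \<Longrightarrow> z \<in> S_rays p \<alpha> \<Longrightarrow> \<exists>x. \<alpha> \<le> x \<and> x \<le> 1 \<and> cmod z = x \<and>
       (x > 0 \<longrightarrow> cmod (ratfun_eval r z - sect p z) = 1 - sector_iter p \<sigma> k x)"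
proof -
  obtain P Q where PQ: "pure_composite k 1 p (Fract P Q)" "Q \<noteq> 0" "degree Q \<le> p ^ k"
    "degree P + (p - 1) \<le> p ^ k"
    and val: "\<And>x \<omega>. 0 \<le> x \<Longrightarrow> x \<le> 1 \<Longrightarrow> \<omega> ^ p = 1 \<Longrightarrow> poly Q (of_real x * \<omega>) \<noteq> 0"
      "\<And>x \<omega>. 0 \<le> x \<Longrightarrow> x \<le> 1 \<Longrightarrow> \<omega> ^ p = 1 \<Longrightarrow>
         poly P (of_real x * \<omega>) / poly Q (of_real x * \<omega>) = \<omega> * of_real (sector_iter p \<sigma> k x)"
    using pure_composite_sector_iter[OF p \<sigma>, of k] k by auto
  have ray: "\<exists>x j. \<alpha> \<le> x \<and> x \<le> 1 \<and> z = of_real x * exp (2 * of_real pi * \<i> * of_nat j / of_nat p)"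
    if "z \<in> S_rays p \<alpha>" for z \<alpha>
    using that by (auto simp: S_rays_def)
  have root: "exp (2 * of_real pi * \<i> * of_nat j / of_nat p) ^ p = (1 :: complex)" for j
    using p
    by (auto simp: exp_of_nat_mult[symmetric] exp_eq_1 intro: exI[of _ "int j"])
  have unit: "cmod (exp (2 * of_real pi * \<i> * of_nat j / of_nat p)) = 1" for j
    by (simp add: norm_exp_eq_Re)
  show ?thesis
  proof (rule that[of "Fract P Q"])
    show "pure_composite k 1 p (Fract P Q)" by fact
    show "ratfun_type (n + 1 - p) n (Fract P Q)"
      unfolding ratfun_type_def using PQ n p by (intro exI[of _ P] exI[of _ Q]) auto
    show "\<not> ratfun_pole (Fract P Q) z" if \<alpha>: "\<alpha> \<ge> 0" and z: "z \<in> S_rays p \<alpha>" for z \<alpha>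
      using ray[OF z] val(1) root ratfun_eval_Fract(1) order.trans[OF \<alpha>] by blast
    show "\<exists>x. \<alpha> \<le> x \<and> x \<le> 1 \<and> cmod z = x \<and>
       (x > 0 \<longrightarrow> cmod (ratfun_eval (Fract P Q) z - sect p z) = 1 - sector_iter p \<sigma> k x)"
      if \<alpha>: "\<alpha> \<ge> 0" and z: "z \<in> S_rays p \<alpha>" for z \<alpha>
    proof -
      obtain x j where xj: "\<alpha> \<le> x" "x \<le> 1"
        and zeq: "z = of_real x * exp (2 * of_real pi * \<i> * of_nat j / of_nat p)"
        using ray[OF z] by blast
      define \<omega> where "\<omega> = exp (2 * of_real pi * \<i> * of_nat j / of_nat p :: complex)"
      have x: "x \<ge> 0" using xj \<alpha> by simp
      have \<omega>: "\<omega> ^ p = 1" "cmod \<omega> = 1" using root unit by (auto simp: \<omega>_def)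
      let ?f = "sector_iter p \<sigma> k x"
      have f: "?f \<le> 1" using sector_iter_bounds[of p \<sigma> x k] p \<sigma> x xj by simp
      have eval: "ratfun_eval (Fract P Q) z = \<omega> * of_real ?f"
        using ratfun_eval_Fract(2)[OF val(1)[OF x xj(2) \<omega>(1)]] val(2)[OF x xj(2) \<omega>(1)]
        by (simp add: zeq \<omega>_def)
      have "cmod (ratfun_eval (Fract P Q) z - sect p z) = 1 - ?f" if "x > 0"
      proof -
        have "sect p z = \<omega>" using sect_ray[of p x j] p that by (simp add: zeq \<omega>_def)
        then have "ratfun_eval (Fract P Q) z - sect p z = \<omega> * of_real (?f - 1)"
          by (simp add: eval algebra_simps)
        then show ?thesis using f by (simp only: norm_mult \<omega>(2) norm_of_real) simp
      qed
      moreover have "cmod z = x" using x \<omega>(2) by (simp add: zeq \<omega>_def norm_mult)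
      ultimately show ?thesis using xj by blast
    qed
  qed
qed

section \<open>Error bounds\<close>

lemma floor_log_power:
  assumes p: "p \<ge> 2" and n: "n \<ge> p"
  defines "k \<equiv> nat \<lfloor>log (real p) (real n)\<rfloor>"
  shows "k > 0" "p ^ k \<le> n" "n \<le> p ^ Suc k"
proof -
  have log: "log (real p) (real n) \<ge> 1" using p n by simp
  then have k: "real k \<le> log (real p) (real n)" "log (real p) (real n) < real k + 1" "k \<ge> 1"
    unfolding k_def by linarith+
  then show "k > 0" by simp
  have pow: "real p powr log (real p) (real n) = real n" using p n by simp
  have "real p ^ k \<le> real n"
    using powr_mono[OF k(1), of "real p"] p by (simp add: pow powr_realpow)
  then show "p ^ k \<le> n" by (metis of_nat_le_iff of_nat_power)
  have "real p powr log (real p) (real n) \<le> real p powr (real (Suc k))"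
    using k(2) p by (intro powr_mono) auto
  then have "real n \<le> real p ^ Suc k"
    using p by (simp only: pow) (simp add: powr_realpow powr_add mult.commute)
  then show "n \<le> p ^ Suc k" by (metis of_nat_le_iff of_nat_power)
qed

lemma power_deficit_le_exp:
  fixes \<alpha> y :: real
  assumes "0 < \<alpha>" "\<alpha> < 1" "\<alpha> \<le> y" "y \<le> 1" "p > 0"
  shows "(1 - y ^ p) ^ m \<le> exp (ln (1 - \<alpha> ^ p) * real m)"
proof -
  have "\<alpha> ^ p < 1" using assms by (simp add: power_less_one_iff)
  then have "(1 - \<alpha> ^ p) ^ m = exp (ln (1 - \<alpha> ^ p) * real m)"
    by (simp add: exp_of_nat2_mult)
  moreover have "(1 - y ^ p) ^ m \<le> (1 - \<alpha> ^ p) ^ m"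
    using assms by (intro power_mono diff_left_mono) (auto simp: power_le_one)
  ultimately show ?thesis by simp
qed

text \<open>
  The fraction \<open>\<theta>\<close> of the \<open>k\<close> steps that are scaled is determined by
  \<open>(p / (p - 1)) powr \<theta> = 2 powr (1 - \<theta>)\<close>, and \<open>c\<close> satisfies
  \<open>p powr c = (p / (p - 1)) powr \<theta>\<close>. The factor \<open>exp (- ((\<theta> + 1) * L))\<close> in \<open>b\<close> accounts for rounding
  \<open>\<theta> * k\<close> and \<open>log p n\<close> to integers.
\<close>

lemma approx_sect_weighted:
  fixes p :: nat and c :: real
  assumes p: "p \<ge> 2"
    and c: "c = (ln (real p / (real p - 1)) * ln 2) / (ln (2 * real p / (real p - 1)) * ln (real p))"
  obtains b where "b > 0"
    "\<And>n. n \<ge> p \<Longrightarrow> \<exists>r. pure_composite (nat \<lfloor>log (real p) (real n)\<rfloor>) 1 p r \<and>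
       ratfun_type (n + 1 - p) n r \<and>
       (\<forall>z \<in> S_full p. \<not> ratfun_pole r z \<and>
          cmod (z * (ratfun_eval r z - sect p z)) \<le> exp (- b * real n powr c))"
proof -
  define L where "L = ln (real p / (real p - 1))"
  define \<theta> where "\<theta> = ln 2 / (ln 2 + L)"
  define \<beta> where "\<beta> = - ln (1 - exp (-1) ^ p :: real)"
  define b where "b = min 1 \<beta> * exp (- ((\<theta> + 1) * L))"
  have L: "L > 0" unfolding L_def using p by (intro ln_gt_zero) (simp add: field_simps)
  have \<theta>: "0 < \<theta>" "\<theta> < 1" using L by (auto simp: \<theta>_def field_simps add_pos_pos)
  have balance: "(1 - \<theta>) * ln 2 = \<theta> * L"
    using L by (simp add: \<theta>_def field_simps add_pos_pos less_imp_neq[symmetric])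
  have "2 * real p / (real p - 1) = 2 * (real p / (real p - 1))" by simp
  also have "ln \<dots> = ln 2 + L" unfolding L_def using p by (intro ln_mult_pos) auto
  finally have c_eq: "c = \<theta> * L / ln (real p)"
    unfolding c \<theta>_def by (simp add: L_def)
  have c_nonneg: "c \<ge> 0" using L \<theta> p by (simp add: c_eq)
  have "exp (-1) ^ p < (1 :: real)" using p by (simp add: power_less_one_iff)
  then have \<beta>: "\<beta> > 0" by (simp add: \<beta>_def ln_less_zero)
  show ?thesis
  proof (rule that[of b])
    show "b > 0" using \<beta> by (simp add: b_def)
    fix n assume n: "n \<ge> p"
    define k where "k = nat \<lfloor>log (real p) (real n)\<rfloor>"
    note k = floor_log_power[OF p n, folded k_def]
    define k1 where "k1 = nat \<lfloor>\<theta> * real k\<rfloor>"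
    have "\<theta> * real k \<ge> 0" using \<theta> by simp
    then have k1: "real k1 \<le> \<theta> * real k" "\<theta> * real k - 1 \<le> real k1"
      unfolding k1_def by linarith+
    have "\<theta> * real k \<le> 1 * real k" using \<theta> by (intro mult_right_mono) auto
    then have "k1 \<le> k" using k1(1) by simp
    define T where "T = exp (real k1 * L)"
    define \<sigma> :: "nat \<Rightarrow> real" where
      "\<sigma> i = (if i < k1 then exp (- (T * ((real p - 1) / real p) ^ i) / real p) else 1)" for i
    have \<sigma>: "\<forall>i. \<sigma> i > 0" by (simp add: \<sigma>_def)
    have T_end: "T * ((real p - 1) / real p) ^ k1 = 1"
    proof -
      have "T = (real p / (real p - 1)) ^ k1"
        using p by (simp add: T_def L_def exp_of_nat_mult)
      then show ?thesis using p by (simp add: power_mult_distrib[symmetric])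
    qed
    (* M bounds n powr c; up to a constant factor it is a lower bound for T and for 2 ^ (k - k1). *)
    define M where "M = exp (\<theta> * L * (real k + 1))"
    have n_le: "real n powr c \<le> M"
    proof -
      have "real n \<le> real p ^ Suc k" using k(3) by (metis of_nat_le_iff of_nat_power)
      then have "ln (real n) \<le> ln (real p ^ Suc k)" using p n by simp
      then have "ln (real n) \<le> (real k + 1) * ln (real p)"
        using p by (simp add: ln_realpow add.commute del: power_Suc)
      then have "c * ln (real n) \<le> c * ((real k + 1) * ln (real p))"
        using c_nonneg by (rule mult_left_mono)
      also have "\<dots> = \<theta> * L * (real k + 1)" using p by (simp add: c_eq)
      finally show ?thesis using p n by (simp add: powr_def M_def)
    qed
    have M: "exp (- ((\<theta> + 1) * L)) * M = exp ((\<theta> * real k - 1) * L)"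
      by (simp add: M_def exp_add[symmetric] algebra_simps)
    have T_ge: "T \<ge> exp (- ((\<theta> + 1) * L)) * M"
      unfolding M T_def using k1(2) L by simp
    have m_ge: "2 ^ (k - k1) \<ge> exp (- ((\<theta> + 1) * L)) * M"
    proof -
      have "(\<theta> * real k - 1) * L \<le> \<theta> * L * real k" using L by (simp add: algebra_simps)
      also have "\<dots> = (1 - \<theta>) * real k * ln 2" using balance by (simp add: mult_ac)
      also have "\<dots> \<le> real (k - k1) * ln 2"
        using k1(1) \<open>k1 \<le> k\<close> by (intro mult_right_mono) (auto simp: of_nat_diff algebra_simps)
      finally have "exp ((\<theta> * real k - 1) * L) \<le> exp (real (k - k1) * ln 2)" by simp
      also have "\<dots> = 2 ^ (k - k1)" by (simp add: exp_of_nat_mult)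
      finally show ?thesis unfolding M .
    qed
    have b_le: "b * real n powr c \<le> min 1 \<beta> * (exp (- ((\<theta> + 1) * L)) * M)"
      unfolding b_def using n_le \<beta> by (simp add: mult_left_mono mult.assoc)
    have bound_T: "b * real n powr c \<le> T"
    proof -
      have "min 1 \<beta> * (exp (- ((\<theta> + 1) * L)) * M) \<le> 1 * T"
        using T_ge \<beta> by (intro mult_mono) (auto simp: M_def T_def)
      then show ?thesis using b_le by simp
    qed
    have bound_m: "b * real n powr c \<le> \<beta> * 2 ^ (k - k1)"
    proof -
      have "min 1 \<beta> * (exp (- ((\<theta> + 1) * L)) * M) \<le> \<beta> * 2 ^ (k - k1)"
        using m_ge \<beta> by (intro mult_mono) (auto simp: M_def)
      then show ?thesis using b_le by simp
    qed
    obtain r where r: "pure_composite k 1 p r" "ratfun_type (n + 1 - p) n r"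
      "\<And>z \<alpha>. \<alpha> \<ge> 0 \<Longrightarrow> z \<in> S_rays p \<alpha> \<Longrightarrow> \<not> ratfun_pole r z"
      "\<And>z \<alpha>. \<alpha> \<ge> 0 \<Longrightarrow> z \<in> S_rays p \<alpha> \<Longrightarrow> \<exists>x. \<alpha> \<le> x \<and> x \<le> 1 \<and> cmod z = x \<and>
         (x > 0 \<longrightarrow> cmod (ratfun_eval r z - sect p z) = 1 - sector_iter p \<sigma> k x)"
      using sector_iter_ratfun[OF p \<sigma> k(1,2)] by blast
    have err: "cmod (z * (ratfun_eval r z - sect p z)) \<le> exp (- b * real n powr c)"
      if z: "z \<in> S_full p" for z
    proof -
      obtain x where x: "0 \<le> x" "x \<le> 1" "cmod z = x"
        "x > 0 \<longrightarrow> cmod (ratfun_eval r z - sect p z) = 1 - sector_iter p \<sigma> k x"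
        using r(4)[OF order.refl z] by blast
      have f: "0 \<le> sector_iter p \<sigma> k x" "sector_iter p \<sigma> k x \<le> 1"
        using sector_iter_bounds[OF p \<sigma> x(1,2)] by auto
      have eq: "cmod (z * (ratfun_eval r z - sect p z)) = x * (1 - sector_iter p \<sigma> k x)"
        using x by (cases "x = 0") (auto simp: norm_mult)
      show ?thesis
      proof (cases "x \<le> exp (- T)")
        case True
        have "x * (1 - sector_iter p \<sigma> k x) \<le> x * 1"
          using x f by (intro mult_left_mono) auto
        also have "\<dots> \<le> exp (- T)" using True by simp
        also have "\<dots> \<le> exp (- b * real n powr c)" using bound_T by simp
        finally show ?thesis using eq by simp
      next
        case False
        let ?y = "sector_iter p \<sigma> k1 x"
        have "exp (- (T * ((real p - 1) / real p) ^ k1)) \<le> ?y"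
          using False x by (intro sector_iter_scaled[OF p \<sigma>]) (auto simp: T_def \<sigma>_def)
        then have y: "exp (-1) \<le> ?y" "?y \<le> 1"
          using sector_iter_bounds[OF p \<sigma> x(1,2)] by (auto simp: T_end)
        have "x * (1 - sector_iter p \<sigma> k x) \<le> 1 * (1 - sector_iter p \<sigma> (k1 + (k - k1)) x)"
          using x f \<open>k1 \<le> k\<close> by (intro mult_mono) auto
        also have "\<dots> \<le> (1 - ?y ^ p) ^ 2 ^ (k - k1)"
          unfolding mult_1_left by (intro sector_iter_unscaled[OF p \<sigma> x(1,2)]) (simp add: \<sigma>_def)
        also have "\<dots> \<le> exp (ln (1 - exp (-1) ^ p) * real (2 ^ (k - k1)))"
          using y p by (intro power_deficit_le_exp) auto
        also have "\<dots> = exp (- (\<beta> * 2 ^ (k - k1)))" by (simp add: \<beta>_def)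
        also have "\<dots> \<le> exp (- b * real n powr c)" using bound_m by simp
        finally show ?thesis using eq by simp
      qed
    qed
    show "\<exists>r. pure_composite (nat \<lfloor>log (real p) (real n)\<rfloor>) 1 p r \<and>
       ratfun_type (n + 1 - p) n r \<and>
       (\<forall>z \<in> S_full p. \<not> ratfun_pole r z \<and>
          cmod (z * (ratfun_eval r z - sect p z)) \<le> exp (- b * real n powr c))"
      using r(1,2) r(3)[of 0] err unfolding k_def by auto
  qed
qed

lemma approx_sect_away_from_0:
  fixes p :: nat and \<alpha> :: real
  assumes p: "p \<ge> 2" and \<alpha>: "0 < \<alpha>" "\<alpha> < 1"
  obtains b where "b > 0"
    "\<And>n. n \<ge> p \<Longrightarrow> \<exists>q. pure_composite (nat \<lfloor>log (real p) (real n)\<rfloor>) 1 p q \<and>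
       ratfun_type (n + 1 - p) n q \<and>
       (\<forall>z \<in> S_rays p \<alpha>. \<not> ratfun_pole q z \<and>
          cmod (ratfun_eval q z - sect p z) \<le> exp (- b * real n powr (ln 2 / ln (real p))))"
proof -
  define \<beta> where "\<beta> = - ln (1 - \<alpha> ^ p)"
  have "0 < \<alpha> ^ p" "\<alpha> ^ p < 1" using p \<alpha> by (auto simp: power_less_one_iff)
  then have \<beta>: "\<beta> > 0" by (simp add: \<beta>_def ln_less_zero)
  show ?thesis
  proof (rule that[of "\<beta> / 2"])
    (* The factor 1 / 2 compensates n < p ^ (k + 1), that is, rounding log p n down to k. *)
    show "\<beta> / 2 > 0" using \<beta> by simp
    fix n assume n: "n \<ge> p"
    define k where "k = nat \<lfloor>log (real p) (real n)\<rfloor>"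
    note k = floor_log_power[OF p n, folded k_def]
    have n_le: "real n powr (ln 2 / ln (real p)) \<le> 2 * 2 ^ k"
    proof -
      have "real n \<le> real p ^ Suc k" using k(3) by (metis of_nat_le_iff of_nat_power)
      then have "ln (real n) \<le> ln (real p ^ Suc k)" using p n by simp
      then have "ln (real n) \<le> real (Suc k) * ln (real p)"
        using p by (simp only: ln_realpow)
      then have "ln 2 / ln (real p) * ln (real n) \<le> ln 2 / ln (real p) * (real (Suc k) * ln (real p))"
        using p by (intro mult_left_mono) auto
      also have "\<dots> = real (Suc k) * ln 2" using p by simp
      finally have "real n powr (ln 2 / ln (real p)) \<le> exp (real (Suc k) * ln 2)"
        using p n by (simp add: powr_def)
      also have "\<dots> = 2 ^ Suc k" by (subst exp_of_nat_mult) simp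
      finally show ?thesis by simp
    qed
    have one: "\<forall>i :: nat. (\<lambda>_. 1 :: real) i > 0" by simp
    obtain q where q: "pure_composite k 1 p q" "ratfun_type (n + 1 - p) n q"
      "\<And>z \<alpha>. \<alpha> \<ge> 0 \<Longrightarrow> z \<in> S_rays p \<alpha> \<Longrightarrow> \<not> ratfun_pole q z"
      "\<And>z \<alpha>. \<alpha> \<ge> 0 \<Longrightarrow> z \<in> S_rays p \<alpha> \<Longrightarrow> \<exists>x. \<alpha> \<le> x \<and> x \<le> 1 \<and> cmod z = x \<and>
         (x > 0 \<longrightarrow> cmod (ratfun_eval q z - sect p z) = 1 - sector_iter p (\<lambda>_. 1) k x)"
      using sector_iter_ratfun[OF p one k(1,2)] by blast
    have err: "cmod (ratfun_eval q z - sect p z) \<le> exp (- (\<beta> / 2) * real n powr (ln 2 / ln (real p)))"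
      if z: "z \<in> S_rays p \<alpha>" for z
    proof -
      obtain x where x: "\<alpha> \<le> x" "x \<le> 1"
        "x > 0 \<longrightarrow> cmod (ratfun_eval q z - sect p z) = 1 - sector_iter p (\<lambda>_. 1) k x"
        using q(4)[OF _ z] \<alpha> by auto
      have "cmod (ratfun_eval q z - sect p z) = 1 - sector_iter p (\<lambda>_. 1) (0 + k) x"
        using x \<alpha> by auto
      also have "\<dots> \<le> (1 - sector_iter p (\<lambda>_. 1) 0 x ^ p) ^ 2 ^ k"
        using p x \<alpha> by (intro sector_iter_unscaled) auto
      also have "\<dots> \<le> exp (ln (1 - \<alpha> ^ p) * real (2 ^ k))"
        using x \<alpha> p unfolding sector_iter.simps by (intro power_deficit_le_exp) auto
      also have "\<dots> = exp (- (\<beta> / 2) * (2 * 2 ^ k))" by (simp add: \<beta>_def)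
      also have "\<dots> \<le> exp (- (\<beta> / 2) * real n powr (ln 2 / ln (real p)))"
        using n_le \<beta> by simp
      finally show ?thesis .
    qed
    show "\<exists>q. pure_composite (nat \<lfloor>log (real p) (real n)\<rfloor>) 1 p q \<and>
       ratfun_type (n + 1 - p) n q \<and>
       (\<forall>z \<in> S_rays p \<alpha>. \<not> ratfun_pole q z \<and>
          cmod (ratfun_eval q z - sect p z) \<le> exp (- (\<beta> / 2) * real n powr (ln 2 / ln (real p))))"
      using q(1,2) q(3)[of \<alpha>] err \<alpha> unfolding k_def by auto
  qed
qed

theorem theorem1p2:
  fixes p :: nat and c c_hat :: real
  assumes "p \<ge> 2"
    and "c = (ln (real p / (real p - 1)) * ln 2) / (ln (2 * real p / (real p - 1)) * ln (real p))"
    and "c_hat = ln 2 / ln (real p)"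
  shows "\<exists>(N::nat) (b::real). N > 0 \<and> b > 0 \<and>
    (\<forall>\<alpha>::real. 0 < \<alpha> \<and> \<alpha> < 1 \<longrightarrow>
      (\<exists>b_hat::real. b_hat > 0 \<and>
        (\<forall>n::nat. n \<ge> N \<longrightarrow>
          (\<exists>r q.
            pure_composite (nat \<lfloor>log (real p) (real n)\<rfloor>) 1 p r \<and>
            ratfun_type (n + 1 - p) n r \<and>
            pure_composite (nat \<lfloor>log (real p) (real n)\<rfloor>) 1 p q \<and>
            ratfun_type (n + 1 - p) n q \<and>
            (\<forall>z \<in> S_full p. \<not> ratfun_pole r z \<and>
               cmod (z * (ratfun_eval r z - sect p z)) \<le> exp (- b * real n powr c)) \<and>
            (\<forall>z \<in> S_rays p \<alpha>. \<not> ratfun_pole q z \<and>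
               cmod (ratfun_eval q z - sect p z) \<le> exp (- b_hat * real n powr c_hat))))))"
proof -
  obtain b where b: "b > 0"
    "\<And>n. n \<ge> p \<Longrightarrow> \<exists>r. pure_composite (nat \<lfloor>log (real p) (real n)\<rfloor>) 1 p r \<and>
       ratfun_type (n + 1 - p) n r \<and>
       (\<forall>z \<in> S_full p. \<not> ratfun_pole r z \<and>
          cmod (z * (ratfun_eval r z - sect p z)) \<le> exp (- b * real n powr c))"
    using approx_sect_weighted[OF assms(1,2)] by blast
  show ?thesis
  proof (rule exI[of _ p], rule exI[of _ b], intro conjI allI impI)
    show "p > 0" using assms(1) by simp
    show "b > 0" by fact
    fix \<alpha> :: real assume \<alpha>: "0 < \<alpha> \<and> \<alpha> < 1"
    then obtain b_hat where b_hat: "b_hat > 0"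
      "\<And>n. n \<ge> p \<Longrightarrow> \<exists>q. pure_composite (nat \<lfloor>log (real p) (real n)\<rfloor>) 1 p q \<and>
         ratfun_type (n + 1 - p) n q \<and>
         (\<forall>z \<in> S_rays p \<alpha>. \<not> ratfun_pole q z \<and>
            cmod (ratfun_eval q z - sect p z) \<le> exp (- b_hat * real n powr c_hat))"
      using approx_sect_away_from_0[OF assms(1), of \<alpha>] unfolding assms(3) by blast
    show "\<exists>b_hat::real. b_hat > 0 \<and>
        (\<forall>n::nat. n \<ge> p \<longrightarrow>
          (\<exists>r q.
            pure_composite (nat \<lfloor>log (real p) (real n)\<rfloor>) 1 p r \<and>
            ratfun_type (n + 1 - p) n r \<and>
            pure_composite (nat \<lfloor>log (real p) (real n)\<rfloor>) 1 p q \<and>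
            ratfun_type (n + 1 - p) n q \<and>
            (\<forall>z \<in> S_full p. \<not> ratfun_pole r z \<and>
               cmod (z * (ratfun_eval r z - sect p z)) \<le> exp (- b * real n powr c)) \<and>
            (\<forall>z \<in> S_rays p \<alpha>. \<not> ratfun_pole q z \<and>
               cmod (ratfun_eval q z - sect p z) \<le> exp (- b_hat * real n powr c_hat))))"
    proof (rule exI[of _ b_hat], intro conjI allI impI)
      fix n assume "p \<le> n"
      with b(2)[of n] b_hat(2)[of n] show "\<exists>r q.
            pure_composite (nat \<lfloor>log (real p) (real n)\<rfloor>) 1 p r \<and>
            ratfun_type (n + 1 - p) n r \<and>
            pure_composite (nat \<lfloor>log (real p) (real n)\<rfloor>) 1 p q \<and>
            ratfun_type (n + 1 - p) n q \<and>
            (\<forall>z \<in> S_full p. \<not> ratfun_pole r z \<and>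
               cmod (z * (ratfun_eval r z - sect p z)) \<le> exp (- b * real n powr c)) \<and>
            (\<forall>z \<in> S_rays p \<alpha>. \<not> ratfun_pole q z \<and>
               cmod (ratfun_eval q z - sect p z) \<le> exp (- b_hat * real n powr c_hat))"
        by fast
    qed (fact b_hat(1))
  qed
qed

end
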